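(* Let $n \geq 3$ and let $C_n^2$ be the square of the cycle $C_n$. If $n$ is even, then $\chi_{\mathrm{star}}'(C_n^2) \leq 9$; if $n$ is odd and $n \notin \{5, 11\}$, then $\chi_{\mathrm{star}}'(C_n^2) \leq 8$.
   Context: All graphs are simple, finite and undirected. $C_n$ is the cycle on $n$ vertices, and $C_n^2$ (a cyclic square graph) is the graph on the same vertex set in which two distinct vertices are adjacent if and only if their distance in $C_n$ is at most $2$. A star $k$-edge-coloring of a graph $G$ is a proper edge-coloring of $G$ with $k$ colors such that no path of length four and no cycle of length four in $G$ (length = number of edges) is bicolored, i.e., at least three colors appear on every path or cycle of length four. The star chromatic index $\chi_{\mathrm{star}}'(G)$ is the smallest $k$ such that $G$ has a star $k$-edge-coloring. *)

theory Defs
  imports Main "HOL-Library.Extended_Nat"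
begin

record 'a ugraph =
  uverts :: "'a set"
  uedges :: "'a set set"

definition simple_graph :: "'a ugraph \<Rightarrow> bool" where
  "simple_graph G \<longleftrightarrow> finite (uverts G) \<and> (\<forall>e \<in> uedges G. e \<subseteq> uverts G \<and> card e = 2)"

subsection \<open>Walks, paths, cycles and distance\<close>

text \<open>
  Walks and paths are nonempty lists of vertices. A cycle is the list of its vertices without
  repeating the start vertex at the end; its closing edge joins the last vertex to the first.
  Lengths count edges.
\<close>

definition is_walk :: "'a ugraph \<Rightarrow> 'a list \<Rightarrow> bool" where
  "is_walk G xs \<longleftrightarrow>
     xs \<noteq> [] \<and> set xs \<subseteq> uverts G \<and> successively (\<lambda>u v. {u, v} \<in> uedges G) xs"

definition walk_edges :: "'a list \<Rightarrow> 'a set list" where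
  "walk_edges xs = map2 (\<lambda>u v. {u, v}) xs (tl xs)"

definition is_path :: "'a ugraph \<Rightarrow> 'a list \<Rightarrow> bool" where
  "is_path G xs \<longleftrightarrow> is_walk G xs \<and> distinct xs"

definition is_cycle :: "'a ugraph \<Rightarrow> 'a list \<Rightarrow> bool" where
  "is_cycle G xs \<longleftrightarrow> is_path G xs \<and> length xs \<ge> 3 \<and> {last xs, hd xs} \<in> uedges G"

definition cycle_edges :: "'a list \<Rightarrow> 'a set list" where
  "cycle_edges xs = walk_edges (xs @ [hd xs])"

definition graph_dist :: "'a ugraph \<Rightarrow> 'a \<Rightarrow> 'a \<Rightarrow> enat" where
  "graph_dist G u v =
     (INF xs \<in> {xs. is_walk G xs \<and> hd xs = u \<and> last xs = v}. enat (length (walk_edges xs)))"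

subsection \<open>Cycles and their squares\<close>

text \<open>This is the cycle on \<open>n\<close> vertices only for \<open>n \<ge> 3\<close>.\<close>

definition cycle_graph :: "nat \<Rightarrow> nat ugraph" where
  "cycle_graph n = \<lparr>uverts = {..<n}, uedges = {{i, (i + 1) mod n} | i. i < n}\<rparr>"

definition graph_square :: "'a ugraph \<Rightarrow> 'a ugraph" where
  "graph_square G =
     \<lparr>uverts = uverts G,
      uedges = {{u, v} | u v. u \<in> uverts G \<and> v \<in> uverts G \<and> u \<noteq> v \<and> graph_dist G u v \<le> 2}\<rparr>"

lemma simple_graph_cycle_graph:
  assumes "n \<ge> 3"
  shows "simple_graph (cycle_graph n)"
proof -
  have "i \<noteq> (i + 1) mod n" if "i < n" for i
    using that assms by (cases "i + 1 = n") auto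
  then show ?thesis
    using assms by (auto simp: simple_graph_def cycle_graph_def card_2_iff)
qed

lemma simple_graph_graph_square: "simple_graph G \<Longrightarrow> simple_graph (graph_square G)"
  by (auto simp: simple_graph_def graph_square_def)

subsection \<open>Star edge-colorings\<close>

definition proper_edge_coloring :: "'a ugraph \<Rightarrow> ('a set \<Rightarrow> nat) \<Rightarrow> bool" where
  "proper_edge_coloring G c \<longleftrightarrow>
     (\<forall>e \<in> uedges G. \<forall>f \<in> uedges G. e \<noteq> f \<and> e \<inter> f \<noteq> {} \<longrightarrow> c e \<noteq> c f)"

text \<open>Only the values of the coloring on the edges of the graph matter; the colors are
  \<open>0, \<dots>, k - 1\<close>, and not all of them need to be used.\<close>

definition star_edge_coloring :: "'a ugraph \<Rightarrow> nat \<Rightarrow> ('a set \<Rightarrow> nat) \<Rightarrow> bool" where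
  "star_edge_coloring G k c \<longleftrightarrow>
     c ` uedges G \<subseteq> {..<k} \<and>
     proper_edge_coloring G c \<and>
     (\<forall>xs. is_path G xs \<and> length (walk_edges xs) = 4 \<longrightarrow> card (c ` set (walk_edges xs)) \<ge> 3) \<and>
     (\<forall>xs. is_cycle G xs \<and> length (cycle_edges xs) = 4 \<longrightarrow> card (c ` set (cycle_edges xs)) \<ge> 3)"

definition star_chromatic_index :: "'a ugraph \<Rightarrow> nat" where
  "star_chromatic_index G = (LEAST k. \<exists>c. star_edge_coloring G k c)"

text \<open>For simple (finite) graphs the minimum is taken over a nonempty set.\<close>

lemma star_edge_coloring_exists:
  assumes "simple_graph G"
  shows "\<exists>k c. star_edge_coloring G k c"
proof -
  have "finite (uedges G)"
    using assms by (intro finite_subset[of "uedges G" "Pow (uverts G)"]) (auto simp: simple_graph_def)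
  then obtain c :: "'a set \<Rightarrow> nat" and k where c: "c ` uedges G = {..<k}" "inj_on c (uedges G)"
    using finite_imp_inj_to_nat_seg[of "uedges G"] by (auto simp: lessThan_def)
  have three: "card (c ` A) \<ge> 3" if "A \<subseteq> uedges G" "card A \<ge> 3" for A
    using that c(2) by (metis card_image inj_on_subset)
  have path: "card (c ` set (walk_edges xs)) \<ge> 3"
    if "is_path G xs" "length (walk_edges xs) = 4" for xs
  proof -
    have "length xs = 5" using that(2) by (simp add: walk_edges_def)
    then obtain v w x y z where xs: "xs = [v, w, x, y, z]"
      by (auto simp: length_Suc_conv eval_nat_numeral)
    show ?thesis
      using that(1) unfolding xs
      by (intro three)
        (auto simp: is_path_def is_walk_def walk_edges_def card_insert_if doubleton_eq_iff)
  qed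
  have cyc: "card (c ` set (cycle_edges xs)) \<ge> 3"
    if "is_cycle G xs" "length (cycle_edges xs) = 4" for xs
  proof -
    have "length xs = 4" using that(2) by (simp add: cycle_edges_def walk_edges_def)
    then obtain w x y z where xs: "xs = [w, x, y, z]"
      by (auto simp: length_Suc_conv eval_nat_numeral)
    show ?thesis
      using that(1) unfolding xs
      by (intro three)
        (auto simp: is_cycle_def is_path_def is_walk_def cycle_edges_def walk_edges_def
          card_insert_if doubleton_eq_iff)
  qed
  have "star_edge_coloring G k c"
    using c path cyc
    by (auto simp: star_edge_coloring_def proper_edge_coloring_def dest: inj_onD)
  then show ?thesis by blast
qed

end

theory Submission
  imports Defs
begin

text \<open>
  \<^bold>\<open>Colorings as cyclic words.\<close> Let \<open>n \<ge> 5\<close>. The square of the \<open>n\<close>-cycle has the \<open>2n\<close> edges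
  \<open>{i, i + 1}\<close> and \<open>{i, i + 2}\<close>, indices taken modulo \<open>n\<close>, so an edge-coloring is a cyclic word of
  length \<open>n\<close> whose \<open>i\<close>-th letter is the pair of colors of these two edges. A bicolored path or cycle
  of length four in a proper coloring is a walk whose colors alternate. Seen from its middle vertex
  \<open>v\<close>, it goes from \<open>v\<close> to two distinct neighbors \<open>p\<close> and \<open>q\<close> by edges of colors \<open>e\<close> and \<open>f\<close>, and then
  on from \<open>p\<close> by an edge of color \<open>f\<close> and from \<open>q\<close> by an edge of color \<open>e\<close>. All these edges lie between
  \<open>v - 4\<close> and \<open>v + 4\<close>, and their colors are read off from seven consecutive letters. Being a
  star edge-coloring therefore follows from a condition on the factors of length seven of the cyclic
  word (\<open>star_edge_coloring_of_star_word\<close>); wrapping around the cycle does no harm, because the walk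
  lifts to the integers.

  \<^bold>\<open>Gluing words.\<close> A factor of length seven of a concatenation whose parts all start with the same
  six letters \<open>t\<close> lies inside one part followed by \<open>t\<close>. So if two words start with \<open>t\<close> and satisfy the
  condition when followed by \<open>t\<close>, their concatenation has this property as well
  (\<open>star_block_append\<close>). There are such words with eight colors, with a common \<open>t\<close>, of each of the
  lengths \<open>7, \<dots>, 13\<close> (\<open>tails_fit_seam\<close>; they come from a computer search). Appending words of length
  seven gives every length from \<open>7\<close> on, so eight colors suffice for all \<open>n \<ge> 7\<close>.

  \<^bold>\<open>Small cycles.\<close> For \<open>n = 6\<close> there is a single explicit word with nine colors. For \<open>n \<le> 4\<close> the square
  is a complete graph with at most six edges, which may all get different colors.
\<close>

section \<open>Words of color pairs\<close>

text \<open>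
  The letter \<open>s i\<close> holds the colors of the edges \<open>{i, i + 1}\<close> and \<open>{i, i + 2}\<close>. The four entries of the
  list belong to the neighbors \<open>2, 3, 5, 6\<close> of the vertex \<open>4\<close>: the color of the edge to the neighbor,
  and the colors of the three other edges at that neighbor. The relation between the entries
  says that the two edges at \<open>4\<close> differ in color and do not form the middle of an alternating walk.
  The condition is spelled out so that it can be evaluated quickly.
\<close>

definition star_window :: "(nat \<Rightarrow> nat \<times> nat) \<Rightarrow> bool" where
  "star_window s \<longleftrightarrow>
     sorted_wrt (\<lambda>(e, E) (f, F). e \<noteq> f \<and> \<not> (f \<in> set E \<and> e \<in> set F))
       [(snd (s 2), [snd (s 0), fst (s 1), fst (s 2)]),
        (fst (s 3), [snd (s 1), fst (s 2), snd (s 3)]),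
        (fst (s 4), [snd (s 3), fst (s 5), snd (s 5)]),
        (snd (s 4), [fst (s 5), fst (s 6), snd (s 6)])]"

definition star_word :: "(nat \<times> nat) list \<Rightarrow> bool" where
  "star_word w \<longleftrightarrow> (\<forall>i \<in> {..<length w - 6}. star_window (\<lambda>j. w ! (i + j)))"

lemma star_window_cong:
  assumes "\<And>j. j < 7 \<Longrightarrow> s j = s' j"
  shows "star_window s = star_window s'"
  using assms[of 0] assms[of 1] assms[of 2] assms[of 3] assms[of 4] assms[of 5] assms[of 6]
  by (simp add: star_window_def)

lemma star_word_prefix:
  assumes "star_word (u @ v)"
  shows "star_word u"
  unfolding star_word_def
proof
  fix i assume i: "i \<in> {..<length u - 6}"
  then have "star_window (\<lambda>j. (u @ v) ! (i + j))"
    using assms by (simp add: star_word_def)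
  also have "star_window (\<lambda>j. (u @ v) ! (i + j)) = star_window (\<lambda>j. u ! (i + j))"
    using i by (intro star_window_cong) (auto simp: nth_append)
  finally show "star_window (\<lambda>j. u ! (i + j))" .
qed

text \<open>
  A window has seven letters, so one that starts inside \<open>x\<close> ends inside \<open>t\<close> at the latest.
\<close>

lemma star_word_glue:
  assumes "length t = 6" "star_word (x @ t)" "star_word (t @ z)"
  shows "star_word (x @ t @ z)"
  unfolding star_word_def
proof
  fix i assume i: "i \<in> {..<length (x @ t @ z) - 6}"
  show "star_window (\<lambda>j. (x @ t @ z) ! (i + j))"
  proof (cases "i < length x")
    case True
    then have "star_window (\<lambda>j. (x @ t) ! (i + j))"
      using assms by (simp add: star_word_def)
    also have "star_window (\<lambda>j. (x @ t) ! (i + j)) = star_window (\<lambda>j. (x @ t @ z) ! (i + j))"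
      using True assms(1) by (intro star_window_cong) (auto simp: nth_append)
    finally show ?thesis .
  next
    case False
    then have "i - length x \<in> {..<length (t @ z) - 6}"
      using assms(1) i by auto
    then have "star_window (\<lambda>j. (t @ z) ! (i - length x + j))"
      using assms(3) unfolding star_word_def by blast
    also have "star_window (\<lambda>j. (t @ z) ! (i - length x + j)) = star_window (\<lambda>j. (x @ t @ z) ! (i + j))"
      using False by (intro star_window_cong) (auto simp: nth_append)
    finally show ?thesis .
  qed
qed

text \<open>
  Blocks with the same \<open>t\<close> can follow each other in any order, and also close up to a cycle: wherever a
  block ends, the next six letters are \<open>t\<close>.
\<close>

definition star_block :: "(nat \<times> nat) list \<Rightarrow> (nat \<times> nat) list \<Rightarrow> bool" where
  "star_block t x \<longleftrightarrow> length t = 6 \<and> take 6 x = t \<and> star_word (x @ t)"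

lemma star_block_append:
  assumes "star_block t x" "star_block t y"
  shows "star_block t (x @ y)"
proof -
  obtain z where y: "y = t @ z"
    using assms(2) by (metis append_take_drop_id star_block_def)
  have "length x \<ge> 6"
    using assms(1) by (auto simp: star_block_def)
  then show ?thesis
    using assms star_word_glue[of t x "z @ t"] by (simp add: star_block_def y)
qed

text \<open>
  Three rounds of the cyclic word contain every window around a vertex of the middle round.
\<close>

lemma star_word_of_star_block:
  assumes "star_block t x"
  shows "star_word (x @ x @ x)"
  using star_block_append[OF assms star_block_append[OF assms assms]]
  by (intro star_word_prefix[of "x @ x @ x" t]) (simp add: star_block_def)

section \<open>From words to walks\<close>

definition near :: "nat \<Rightarrow> nat set" where
  "near v = {v - 2, v - 1, v + 1, v + 2}"

text \<open>
  This is the color of the edge between two vertices at distance one or two on the integer line.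
\<close>

definition link_color :: "(nat \<Rightarrow> nat \<times> nat) \<Rightarrow> nat \<Rightarrow> nat \<Rightarrow> nat" where
  "link_color s u v = (if max u v = min u v + 1 then fst (s (min u v)) else snd (s (min u v)))"

text \<open>
  This translates the list of colors in a window back into a statement about walks with middle
  vertex \<open>4\<close>, in which backtracking is excluded.
\<close>

lemma star_windowD:
  assumes "star_window s" "p \<in> near 4" "q \<in> near 4" "p \<noteq> q"
  shows "link_color s 4 p \<noteq> link_color s 4 q"
    and "\<lbrakk>p' \<in> near p; q' \<in> near q; p' \<noteq> 4; q' \<noteq> 4; link_color s p p' = link_color s 4 q;
          link_color s q q' = link_color s 4 p\<rbrakk> \<Longrightarrow> False"
proof -
  \<comment> \<open>\<open>L v\<close> lists the colors of the edges from a neighbor \<open>v\<close> of \<open>4\<close> to the vertices other than \<open>4\<close>.\<close>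
  define L where "L = (\<lambda>v :: nat. if v = 2 then [snd (s 0), fst (s 1), fst (s 2)]
    else if v = 3 then [snd (s 1), fst (s 2), snd (s 3)]
    else if v = 5 then [snd (s 3), fst (s 5), snd (s 5)]
    else [fst (s 5), fst (s 6), snd (s 6)])"
  have L: "link_color s v v' \<in> set (L v)" if "v \<in> near 4" "v' \<in> near v" "v' \<noteq> 4" for v v'
    using that by (auto simp: near_def L_def link_color_def)
  define R where "R = (\<lambda>(e :: nat, E) (f, F). e \<noteq> f \<and> \<not> (f \<in> set E \<and> e \<in> set F))"
  define star where "star = (\<lambda>v. (link_color s 4 v, L v))"
  have "sorted_wrt R (map star [2, 3, 5, 6])"
    using assms(1) by (simp add: star_window_def R_def star_def L_def link_color_def del: sorted_wrt.simps)
  \<comment> \<open>The list is ordered by neighbor, so only one of the two orders is available.\<close>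
  then have "R (star p) (star q) \<or> R (star q) (star p)"
    using assms(2-4) by (auto simp: near_def)
  then have W': "link_color s 4 p \<noteq> link_color s 4 q \<and>
       \<not> (link_color s 4 q \<in> set (L p) \<and> link_color s 4 p \<in> set (L q))"
    by (auto simp: R_def star_def)
  then show "link_color s 4 p \<noteq> link_color s 4 q" by blast
  assume "p' \<in> near p" "q' \<in> near q" "p' \<noteq> 4" "q' \<noteq> 4" "link_color s p p' = link_color s 4 q"
         "link_color s q q' = link_color s 4 p"
  then show False
    using L[of p p'] L[of q q'] assms(2,3) W' by auto
qed

section \<open>Lifting the square of a cycle to the integer line\<close>

definition word_coloring :: "(nat \<times> nat) list \<Rightarrow> nat set \<Rightarrow> nat" where
  "word_coloring x e =
     (THE k. \<exists>i<length x. e = {i, (i + 1) mod length x} \<and> k = fst (x ! i) \<or>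
                         e = {i, (i + 2) mod length x} \<and> k = snd (x ! i))"

text \<open>
  This is where \<open>n \<ge> 5\<close> is essential: for \<open>n = 4\<close> the pairs \<open>{0, 2}\<close> and \<open>{2, 4 mod 4}\<close> coincide, and for
  \<open>n = 3\<close> so do \<open>{0, 1}\<close> and \<open>{1, 3 mod 3}\<close>.
\<close>

lemma cyclic_pair_unique:
  fixes n i j d d' :: nat
  assumes "5 \<le> n" "i < n" "j < n" "d \<in> {1, 2}" "d' \<in> {1, 2}"
    and "{i, (i + d) mod n} = {j, (j + d') mod n}"
  shows "i = j \<and> d = d'"
proof -
  have m: "(k + e) mod n = (if k + e < n then k + e else k + e - n)" if "k < n" "e \<in> {1, 2}" for k e
    using that assms(1) by (auto simp: le_mod_geq)
  show ?thesis
    using assms(6) unfolding m[OF assms(2,4)] m[OF assms(3,5)] doubleton_eq_iff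
    using assms(1-5) by (auto split: if_splits)
qed

lemma word_coloring_eq:
  assumes "5 \<le> length x" "i < length x"
  shows "word_coloring x {i, (i + 1) mod length x} = fst (x ! i)"
    and "word_coloring x {i, (i + 2) mod length x} = snd (x ! i)"
proof -
  note u = cyclic_pair_unique[OF assms]
  show "word_coloring x {i, (i + 1) mod length x} = fst (x ! i)"
    unfolding word_coloring_def
    by (rule the_equality) (use assms in \<open>auto dest: u[of _ 1 1, simplified] u[of _ 1 2, simplified]\<close>)
  show "word_coloring x {i, (i + 2) mod length x} = snd (x ! i)"
    unfolding word_coloring_def
    by (rule the_equality) (use assms in \<open>auto dest: u[of _ 2 1, simplified] u[of _ 2 2, simplified]\<close>)
qed

lemma word_coloring_lift:
  assumes "5 \<le> length x" "2 \<le> U" "W \<in> near U"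
  shows "word_coloring x {U mod length x, W mod length x} =
         link_color (\<lambda>i. x ! (i mod length x)) U W"
proof -
  have up: "word_coloring x {V mod length x, (V + d) mod length x} =
            link_color (\<lambda>i. x ! (i mod length x)) V (V + d)" if "d \<in> {1, 2}" for V d
  proof -
    have "V mod length x < length x"
      using assms(1) by (intro mod_less_divisor) linarith
    note word_coloring_eq[OF assms(1) this]
    then show ?thesis
      using that by (auto simp: link_color_def mod_simps)
  qed
  have sym: "link_color s a b = link_color s b a" for s a b
    by (simp add: link_color_def max.commute min.commute)
  from assms(2,3) consider d where "d \<in> {1, 2}" "W = U + d" | d where "d \<in> {1, 2}" "U = W + d"
    by (fastforce simp: near_def)
  then show ?thesis
  proof cases
    case 1
    then show ?thesis using up by simp
  next
    case 2
    then show ?thesis using up[of d W] sym[of _ U W] by (simp add: insert_commute)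
  qed
qed

text \<open>
  The lower bound on the lift leaves room for a step to the left without truncated subtraction;
  the bound in \<open>cycle_square_edge_lift\<close> does the same for steps of length two.
\<close>

lemma cycle_step_lift:
  assumes "{x, y} \<in> uedges (cycle_graph n)" "1 \<le> X" "x = X mod n"
  shows "\<exists>Y\<in>{X - 1, X + 1}. y = Y mod n"
proof -
  obtain i where i: "i < n" "{x, y} = {i, (i + 1) mod n}"
    using assms(1) by (auto simp: cycle_graph_def)
  then consider "x = i" "y = (i + 1) mod n" | "y = i" "x = (i + 1) mod n"
    by (auto simp: doubleton_eq_iff)
  then show ?thesis
  proof cases
    case 1
    then show ?thesis using assms(3) by (auto simp: mod_simps)
  next
    case 2
    obtain Z where Z: "X = Suc Z" using assms(2) by (cases X) auto
    have "Suc (Z mod n) mod n = Suc i mod n"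
      using 2 assms(3) Z by (simp add: mod_simps)
    then have "Z mod n = i"
      using i(1) by (auto simp: mod_Suc split: if_splits)
    then show ?thesis using 2 Z by auto
  qed
qed

lemma graph_dist_le_2D:
  assumes "graph_dist G u v \<le> 2" "u \<noteq> v"
  shows "{u, v} \<in> uedges G \<or> (\<exists>w. {u, w} \<in> uedges G \<and> {w, v} \<in> uedges G)"
proof -
  have "\<exists>xs. is_walk G xs \<and> hd xs = u \<and> last xs = v \<and> length (walk_edges xs) \<le> 2"
  proof (rule ccontr)
    assume "\<not> ?thesis"
    then have "enat 3 \<le> graph_dist G u v"
      unfolding graph_dist_def by (intro INF_greatest) (auto simp: not_le Suc_le_eq eval_nat_numeral)
    then have "enat 3 \<le> 2"
      using assms(1) by (rule order_trans)
    then show False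
      by (simp add: numeral_eq_enat)
  qed
  then obtain xs where xs: "is_walk G xs" "hd xs = u" "last xs = v" "length xs - 1 \<le> 2"
    by (auto simp: walk_edges_def)
  then obtain y ys where ys: "xs = y # ys" "length ys \<le> 2"
    by (cases xs) (auto simp: is_walk_def)
  then consider "ys = []" | a where "ys = [a]" | a b where "ys = [a, b]"
    by (cases ys; cases "tl ys") auto
  then show ?thesis
    using xs ys(1) assms(2) by cases (auto simp: is_walk_def)
qed

lemma cycle_square_edge_lift:
  assumes "{u, w} \<in> uedges (graph_square (cycle_graph n))" "2 \<le> U" "u = U mod n"
  shows "\<exists>W\<in>near U. w = W mod n"
proof -
  obtain a b where ab: "{u, w} = {a, b}" "a \<noteq> b" "graph_dist (cycle_graph n) a b \<le> 2"
    using assms(1) by (auto simp: graph_square_def)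
  have "u \<noteq> w" using ab by auto
  have "{u, w} \<in> uedges (cycle_graph n) \<or>
        (\<exists>m. {u, m} \<in> uedges (cycle_graph n) \<and> {m, w} \<in> uedges (cycle_graph n))"
    using graph_dist_le_2D[OF ab(3,2)] ab(1) by (auto simp: doubleton_eq_iff insert_commute)
  then show ?thesis
  proof (elim disjE exE conjE)
    assume "{u, w} \<in> uedges (cycle_graph n)"
    from cycle_step_lift[OF this _ assms(3)] assms(2) show ?thesis
      by (auto simp: near_def)
  next
    fix m assume m: "{u, m} \<in> uedges (cycle_graph n)" "{m, w} \<in> uedges (cycle_graph n)"
    from cycle_step_lift[OF m(1) _ assms(3)] assms(2)
    obtain M where M: "M \<in> {U - 1, U + 1}" "m = M mod n" by auto
    then have "1 \<le> M" using assms(2) by auto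
    from cycle_step_lift[OF m(2) this M(2)]
    obtain W where W: "W \<in> {M - 1, M + 1}" "w = W mod n" by auto
    then have "W \<noteq> U"
      using assms(3) \<open>u \<noteq> w\<close> by auto
    then have "W \<in> near U"
      using W(1) M(1) assms(2) by (auto simp: near_def numeral_2_eq_2)
    then show ?thesis using W(2) by blast
  qed
qed

lemma nth_triple:
  assumes "i < 3 * length x"
  shows "(x @ x @ x) ! i = x ! (i mod length x)"
proof -
  consider "i < length x" | "length x \<le> i" "i < 2 * length x" | "2 * length x \<le> i" by linarith
  then show ?thesis
    using assms by cases (auto simp: nth_append le_mod_geq)
qed

lemma star_window_periodic:
  assumes "5 \<le> length x" "star_word (x @ x @ x)" "v < length x"
  shows "star_window (\<lambda>j. x ! ((v + length x - 4 + j) mod length x))"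
proof -
  have "v + length x - 4 \<in> {..<length (x @ x @ x) - 6}"
    using assms(1,3) by auto
  then have "star_window (\<lambda>j. (x @ x @ x) ! (v + length x - 4 + j))"
    using assms(2) unfolding star_word_def by blast
  also have "star_window (\<lambda>j. (x @ x @ x) ! (v + length x - 4 + j)) =
             star_window (\<lambda>j. x ! ((v + length x - 4 + j) mod length x))"
    using assms by (intro star_window_cong nth_triple) auto
  finally show ?thesis .
qed

lemma near_shift: "2 \<le> v \<Longrightarrow> near (a + v) = (+) a ` near v"
  by (auto simp: near_def)

lemma link_color_shift: "link_color s (a + u) (a + v) = link_color (\<lambda>j. s (a + j)) u v"
  by (simp add: link_color_def max_def min_def)

text \<open>
  The index \<open>V - 4\<close> moves the middle vertex \<open>4\<close> of a window to \<open>V\<close>.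
\<close>

lemma star_window_at:
  assumes "4 \<le> V" "star_window (\<lambda>j. s (V - 4 + j))" "P \<in> near V" "Q \<in> near V" "P \<noteq> Q"
  shows "link_color s V P \<noteq> link_color s V Q"
    and "\<lbrakk>P' \<in> near P; Q' \<in> near Q; P' \<noteq> V; Q' \<noteq> V; link_color s P P' = link_color s V Q;
          link_color s Q Q' = link_color s V P\<rbrakk> \<Longrightarrow> False"
proof -
  define a where "a = V - 4"
  have V: "V = a + 4" using assms(1) by (simp add: a_def)
  obtain p q where pq: "p \<in> near 4" "P = a + p" "q \<in> near 4" "Q = a + q" "p \<noteq> q"
    using assms(3-5) by (auto simp: V near_shift)
  note W = star_windowD[OF assms(2)[folded a_def] pq(1,3,5)]
  show "link_color s V P \<noteq> link_color s V Q"
    using W(1) by (simp add: V pq link_color_shift)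
  assume *: "P' \<in> near P" "Q' \<in> near Q" "P' \<noteq> V" "Q' \<noteq> V" "link_color s P P' = link_color s V Q"
          "link_color s Q Q' = link_color s V P"
  have ge: "2 \<le> p" "2 \<le> q"
    using pq(1,3) by (auto simp: near_def)
  obtain p' q' where "p' \<in> near p" "P' = a + p'" "q' \<in> near q" "Q' = a + q'"
    using *(1,2) by (auto simp: pq near_shift ge)
  then show False
    using W(2)[of p' q'] *(3-) by (auto simp: V pq(2,4) link_color_shift)
qed

lemma two_colors_alternate:
  assumes "a \<noteq> b" "b \<noteq> c" "c \<noteq> d" "card {a, b, c, d} < 3"
  shows "a = c \<and> b = d"
  using assms by (auto simp: card_insert_if split: if_splits)

text \<open>
  A path of length four is a walk through five distinct vertices, and a cycle of length four is one
  that returns to its start. Both lift, starting from the middle vertex, to walks on the integer line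
  that never backtrack, and on these the windows of the word forbid alternating colors.
\<close>

lemma star_edge_coloring_of_star_word:
  assumes "5 \<le> length x" "star_word (x @ x @ x)" "\<And>a b. (a, b) \<in> set x \<Longrightarrow> a < k \<and> b < k"
  shows "star_edge_coloring (graph_square (cycle_graph (length x))) k (word_coloring x)"
proof -
  define n where "n = length x"
  define G where "G = graph_square (cycle_graph n)"
  define s where "s = (\<lambda>i. x ! (i mod n))"
  define c where "c = word_coloring x"
  have n: "5 \<le> n" using assms(1) n_def by simp
  have edge: "\<exists>u w. e = {u, w} \<and> u < n \<and> w < n \<and> u \<noteq> w" if "e \<in> uedges G" for e
    using that by (auto simp: G_def graph_square_def cycle_graph_def)
  have lift: "\<exists>W\<in>near U. w = W mod n \<and> c {u, w} = link_color s U W"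
    if "{u, w} \<in> uedges G" "2 \<le> U" "u = U mod n" for u w U
    using cycle_square_edge_lift[of u w n U] word_coloring_lift[of x U] that assms(1)
    by (auto simp: G_def c_def s_def n_def)
  \<comment> \<open>Every vertex \<open>v\<close> is lifted to \<open>v + n\<close>: the four vertices to its left, which the condition
    around \<open>v\<close> involves, then have natural number lifts too.\<close>
  have window: "star_window (\<lambda>j. s (v + n - 4 + j))" if "v < n" for v
    using star_window_periodic[OF assms(1,2)] that by (simp add: s_def n_def)

  have colors: "c e < k" if E: "e \<in> uedges G" for e
  proof -
    obtain u w where e: "e = {u, w}" "u < n" using edge[OF E] by blast
    obtain W where "c e = link_color s (u + n) W"
      using lift[of u w "u + n"] E e n by auto
    moreover have "fst (s i) < k \<and> snd (s i) < k" for i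
      using assms(3)[of "fst (s i)" "snd (s i)"] n
      by (simp add: s_def n_def[symmetric] nth_mem)
    ultimately show ?thesis by (simp add: link_color_def)
  qed

  have proper: "c {v, p} \<noteq> c {v, q}"
    if E: "{v, p} \<in> uedges G" "{v, q} \<in> uedges G" and D: "p \<noteq> q" for v p q
  proof -
    have v: "v < n" using edge[OF E(1)] by (auto simp: doubleton_eq_iff)
    obtain P where P: "P \<in> near (v + n)" "p = P mod n" "c {v, p} = link_color s (v + n) P"
      using lift[OF E(1), of "v + n"] v n by auto
    obtain Q where Q: "Q \<in> near (v + n)" "q = Q mod n" "c {v, q} = link_color s (v + n) Q"
      using lift[OF E(2), of "v + n"] v n by auto
    show ?thesis
      using star_window_at(1)[of "v + n" s P Q] window[OF v] P Q D n by auto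
  qed

  \<comment> \<open>The end vertices \<open>a\<close> and \<open>b\<close> may coincide, so this covers paths and cycles at once.\<close>
  have no_alternation: False
    if E: "{a, p} \<in> uedges G" "{p, v} \<in> uedges G" "{v, q} \<in> uedges G" "{q, b} \<in> uedges G"
      and D: "a \<noteq> v" "p \<noteq> q" "b \<noteq> v"
      and C: "c {a, p} = c {v, q}" "c {p, v} = c {q, b}" for a p v q b
  proof -
    have E': "{v, p} \<in> uedges G" "{p, a} \<in> uedges G"
      using E by (simp_all add: insert_commute)
    have v: "v < n" using edge[OF E(3)] by (auto simp: doubleton_eq_iff)
    obtain P where P: "P \<in> near (v + n)" "p = P mod n" "c {v, p} = link_color s (v + n) P"
      using lift[OF E'(1), of "v + n"] v n by auto
    obtain Q where Q: "Q \<in> near (v + n)" "q = Q mod n" "c {v, q} = link_color s (v + n) Q"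
      using lift[OF E(3), of "v + n"] v n by auto
    have ge: "2 \<le> P" "2 \<le> Q" using P(1) Q(1) n by (auto simp: near_def)
    obtain A where A: "A \<in> near P" "a = A mod n" "c {p, a} = link_color s P A"
      using lift[OF E'(2) ge(1) P(2)] by auto
    obtain B where B: "B \<in> near Q" "b = B mod n" "c {q, b} = link_color s Q B"
      using lift[OF E(4) ge(2) Q(2)] by auto
    have "A \<noteq> v + n" "B \<noteq> v + n" "P \<noteq> Q"
      using A B P Q D v by auto
    then show False
      using star_window_at(2)[of "v + n" s P Q A B] window[OF v] P Q A B C n
      by (auto simp: insert_commute)
  qed

  have four: "card {c {a, p}, c {p, v}, c {v, q}, c {q, b}} \<ge> 3"
    if E: "{a, p} \<in> uedges G" "{p, v} \<in> uedges G" "{v, q} \<in> uedges G" "{q, b} \<in> uedges G"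
      and D: "a \<noteq> v" "p \<noteq> q" "b \<noteq> v" for a p v q b
  proof (rule ccontr)
    assume less: "\<not> ?thesis"
    have "c {a, p} \<noteq> c {p, v}" "c {p, v} \<noteq> c {v, q}" "c {v, q} \<noteq> c {q, b}"
      using proper[of p a v] proper[of v p q] proper[of q v b] E D by (auto simp: insert_commute)
    from two_colors_alternate[OF this] less have "c {a, p} = c {v, q} \<and> c {p, v} = c {q, b}"
      by simp
    then show False using no_alternation[OF E D] by blast
  qed

  have "proper_edge_coloring G c"
    unfolding proper_edge_coloring_def
  proof (intro ballI impI)
    fix e f assume ef: "e \<in> uedges G" "f \<in> uedges G" "e \<noteq> f \<and> e \<inter> f \<noteq> {}"
    then obtain v where "v \<in> e" "v \<in> f" by auto
    then obtain p q where "e = {v, p}" "f = {v, q}"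
      using edge[OF ef(1)] edge[OF ef(2)] by (auto simp: insert_commute)
    then show "c e \<noteq> c f" using proper[of v p q] ef by auto
  qed
  moreover have "card (c ` set (walk_edges xs)) \<ge> 3"
    if "is_path G xs" "length (walk_edges xs) = 4" for xs
  proof -
    have "length xs = 5" using that(2) by (simp add: walk_edges_def)
    then obtain a p v q b where xs: "xs = [a, p, v, q, b]"
      by (auto simp: length_Suc_conv eval_nat_numeral)
    show ?thesis
      using that(1) four[of a p v q b] unfolding xs
      by (auto simp: is_path_def is_walk_def walk_edges_def)
  qed
  moreover have "card (c ` set (cycle_edges xs)) \<ge> 3"
    if "is_cycle G xs" "length (cycle_edges xs) = 4" for xs
  proof -
    have "length xs = 4" using that(2) by (simp add: cycle_edges_def walk_edges_def)
    then obtain a p v q where xs: "xs = [a, p, v, q]"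
      by (auto simp: length_Suc_conv eval_nat_numeral)
    show ?thesis
      using that(1) four[of a p v q a] unfolding xs
      by (auto simp: is_cycle_def is_path_def is_walk_def cycle_edges_def walk_edges_def)
  qed
  ultimately have "star_edge_coloring G k c"
    using colors by (auto simp: star_edge_coloring_def)
  then show ?thesis by (simp add: G_def c_def n_def)
qed

section \<open>Bounds on the star chromatic index\<close>

lemma star_chromatic_index_le: "star_edge_coloring G k c \<Longrightarrow> star_chromatic_index G \<le> k"
  unfolding star_chromatic_index_def by (rule Least_le) blast

text \<open>
  If all edges get different colors, even four colors appear on every path or cycle of length four.
\<close>

lemma star_chromatic_index_le_card_edges:
  assumes "simple_graph G"
  shows "star_chromatic_index G \<le> card (uedges G)"
proof -
  have fin: "finite (uedges G)"
    using assms by (intro finite_subset[of "uedges G" "Pow (uverts G)"]) (auto simp: simple_graph_def)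
  then obtain c where c: "bij_betw c (uedges G) {..<card (uedges G)}"
    using ex_bij_betw_finite_nat[of "uedges G"] by (auto simp: lessThan_atLeast0)
  have three: "card (c ` A) \<ge> 3" if "A \<subseteq> uedges G" "card A \<ge> 3" for A
    using that c by (metis bij_betw_imp_inj_on card_image inj_on_subset)
  have "card (c ` set (walk_edges xs)) \<ge> 3"
    if "is_path G xs" "length (walk_edges xs) = 4" for xs
  proof -
    have "length xs = 5" using that(2) by (simp add: walk_edges_def)
    then obtain v w x y z where xs: "xs = [v, w, x, y, z]"
      by (auto simp: length_Suc_conv eval_nat_numeral)
    show ?thesis
      using that(1) unfolding xs
      by (intro three) (auto simp: is_path_def is_walk_def walk_edges_def card_insert_if doubleton_eq_iff)
  qed
  moreover have "card (c ` set (cycle_edges xs)) \<ge> 3"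
    if "is_cycle G xs" "length (cycle_edges xs) = 4" for xs
  proof -
    have "length xs = 4" using that(2) by (simp add: cycle_edges_def walk_edges_def)
    then obtain w x y z where xs: "xs = [w, x, y, z]"
      by (auto simp: length_Suc_conv eval_nat_numeral)
    show ?thesis
      using that(1) unfolding xs
      by (intro three) (auto simp: is_cycle_def is_path_def is_walk_def cycle_edges_def walk_edges_def
          card_insert_if doubleton_eq_iff)
  qed
  moreover have "proper_edge_coloring G c"
    using c unfolding proper_edge_coloring_def by (meson bij_betw_imp_inj_on inj_onD)
  moreover have "c ` uedges G \<subseteq> {..<card (uedges G)}"
    using c by (simp add: bij_betw_def)
  ultimately have "star_edge_coloring G (card (uedges G)) c"
    by (simp add: star_edge_coloring_def)
  then show ?thesis by (rule star_chromatic_index_le)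
qed

lemma card_edges_le_choose:
  assumes "simple_graph G"
  shows "card (uedges G) \<le> card (uverts G) choose 2"
proof -
  have "uedges G \<subseteq> {e. e \<subseteq> uverts G \<and> card e = 2}" "finite (uverts G)"
    using assms by (auto simp: simple_graph_def)
  then have "card (uedges G) \<le> card {e. e \<subseteq> uverts G \<and> card e = 2}"
    by (intro card_mono) auto
  then show ?thesis
    using n_subsets[OF \<open>finite (uverts G)\<close>] by simp
qed

section \<open>The words for all lengths\<close>

text \<open>
  These letters and those of \<open>tails\<close> are a solution of a satisfiability problem that asks for cyclic
  words of the lengths \<open>7, \<dots>, 13\<close> at once, with a common beginning of six letters.
\<close>

definition seam :: "(nat \<times> nat) list" where
  "seam = [(6, 3), (1, 2), (0, 2), (4, 6), (3, 6), (1, 5)]"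

definition tails :: "(nat \<times> nat) list list" where
  "tails =
    [[(0, 7)],
     [(0, 7), (4, 3)],
     [(7, 0), (2, 0), (4, 3)],
     [(7, 2), (0, 3), (1, 5), (4, 7)],
     [(0, 7), (1, 2), (3, 4), (6, 5), (0, 7)],
     [(0, 2), (7, 4), (3, 0), (1, 2), (6, 5), (4, 7)],
     [(2, 5), (7, 0), (4, 0), (1, 2), (6, 3), (1, 4), (7, 5)]]"

lemma tails_fit_seam:
  "\<forall>y\<in>set tails. star_block seam (seam @ y) \<and> (\<forall>(a, b)\<in>set (seam @ y). a < 8 \<and> b < 8)"
  by code_simp

definition six_word :: "(nat \<times> nat) list" where
  "six_word = [(0, 2), (6, 2), (7, 8), (4, 8), (0, 3), (1, 5)]"

lemma star_word_six_word:
  "star_word (six_word @ six_word @ six_word)" "\<forall>(a, b)\<in>set six_word. a < 9 \<and> b < 9"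
  by code_simp+

text \<open>
  The lengths \<open>7, \<dots>, 13\<close> meet every residue class modulo \<open>7\<close>, so copies of the word of length seven
  reach all other lengths.
\<close>

lemma star_block_of_length:
  assumes "7 \<le> n"
  shows "\<exists>x. length x = n \<and> star_block seam x \<and> (\<forall>(a, b)\<in>set x. a < 8 \<and> b < 8)"
  using assms
proof (induction n rule: less_induct)
  case (less n)
  show ?case
  proof (cases "n < 14")
    case True
    then have "n - 6 \<in> length ` set tails"
      using less.prems by (auto simp: tails_def image_iff)
    then obtain y where y: "y \<in> set tails" "length y = n - 6"
      by auto
    then have "length (seam @ y) = n"
      using less.prems by (simp add: seam_def)
    then show ?thesis
      using tails_fit_seam y(1) by blast
  next
    case False
    then have "n - 7 < n" "7 \<le> n - 7" by auto
    from less.IH[OF this] obtain x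
      where x: "length x = n - 7" "star_block seam x" "\<forall>(a, b)\<in>set x. a < 8 \<and> b < 8"
      by blast
    have y: "star_block seam (seam @ hd tails)" "\<forall>(a, b)\<in>set (seam @ hd tails). a < 8 \<and> b < 8"
      using tails_fit_seam by (simp_all add: tails_def)
    have "length ((seam @ hd tails) @ x) = n"
      using x(1) False by (simp add: seam_def tails_def)
    moreover have "\<forall>(a, b)\<in>set ((seam @ hd tails) @ x). a < 8 \<and> b < 8"
      using x(3) y(2) by auto
    ultimately show ?thesis
      using star_block_append[OF y(1) x(2)] by blast
  qed
qed

lemma star_chromatic_index_cycle_square_le_8:
  assumes "7 \<le> n"
  shows "star_chromatic_index (graph_square (cycle_graph n)) \<le> 8"
proof -
  obtain x where x: "length x = n" "star_block seam x" "\<forall>(a, b)\<in>set x. a < 8 \<and> b < 8"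
    using star_block_of_length[OF assms] by blast
  have "star_edge_coloring (graph_square (cycle_graph (length x))) 8 (word_coloring x)"
    using x assms by (intro star_edge_coloring_of_star_word star_word_of_star_block) auto
  then show ?thesis
    using star_chromatic_index_le x(1) by blast
qed

lemma star_chromatic_index_cycle_square_6_le_9:
  "star_chromatic_index (graph_square (cycle_graph 6)) \<le> 9"
proof -
  have "star_edge_coloring (graph_square (cycle_graph (length six_word))) 9 (word_coloring six_word)"
    using star_word_six_word by (intro star_edge_coloring_of_star_word) (auto simp: six_word_def)
  moreover have "length six_word = 6"
    by (simp add: six_word_def)
  ultimately show ?thesis
    using star_chromatic_index_le by metis
qed

lemma star_chromatic_index_cycle_square_le_6:
  assumes "n \<in> {3, 4}"
  shows "star_chromatic_index (graph_square (cycle_graph n)) \<le> 6"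
proof -
  let ?G = "graph_square (cycle_graph n)"
  have G: "simple_graph ?G"
    using assms by (intro simple_graph_graph_square simple_graph_cycle_graph) auto
  have "star_chromatic_index ?G \<le> card (uedges ?G)"
    by (rule star_chromatic_index_le_card_edges[OF G])
  also have "\<dots> \<le> n choose 2"
    using card_edges_le_choose[OF G] by (simp add: graph_square_def cycle_graph_def)
  also have "\<dots> \<le> 6"
    using assms by (auto simp: choose_two)
  finally show ?thesis .
qed

theorem theorem3p2:
  fixes n :: nat
  assumes "n \<ge> 3"
  shows "(even n \<longrightarrow> star_chromatic_index (graph_square (cycle_graph n)) \<le> 9) \<and>
         (odd n \<and> n \<notin> {5, 11} \<longrightarrow> star_chromatic_index (graph_square (cycle_graph n)) \<le> 8)"
proof -
  consider "n \<in> {3, 4}" | "n = 5" | "n = 6" | "7 \<le> n"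
    using assms by force
  then show ?thesis
  proof cases
    case 1
    then show ?thesis using star_chromatic_index_cycle_square_le_6[of n] by auto
  next
    case 3
    then show ?thesis using star_chromatic_index_cycle_square_6_le_9 by simp
  next
    case 4
    then show ?thesis using star_chromatic_index_cycle_square_le_8[of n] by auto
  qed simp
qed

end
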